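(* Let $\mathcal{A}$, $\mathcal{F}$, $\mathcal{R}$ be Boolean tensors of sizes $I_1\times\cdots\times I_M\times J_1\times\cdots\times J_N$, $I_1\times\cdots\times I_M\times K_1\times\cdots\times K_L$ and $K_1\times\cdots\times K_L\times J_1\times\cdots\times J_N$ respectively, and suppose that $\mathcal{A}=\mathcal{F}*_L\mathcal{R}$ is a space decomposition of $\mathcal{A}$. Then a generalized inverse $\mathcal{A}^{(1)}$ of $\mathcal{A}$ exists.
   Context: A Boolean tensor is an array with entries in $\{0,1\}$; entries are added and multiplied by the rules of the binary Boolean algebra ($1+1=1$, otherwise as usual). For $\mathcal{A}$ of size $I_1\times\cdots\times I_M\times J_1\times\cdots\times J_N$ and $\mathcal{B}$ of size $J_1\times\cdots\times J_N\times K_1\times\cdots\times K_L$, the Einstein product $\mathcal{A}*_N\mathcal{B}$ has entries $\sum_{j_1,\dots,j_N}a_{i_1\ldots i_Mj_1\ldots j_N}b_{j_1\ldots j_Nk_1\ldots k_L}$ (Boolean sum; the $k$-indices may be absent); the subscript of $*$ is the number of contracted indices. The transpose is $(\mathcal{A}^T)_{j_1\ldots j_Ni_1\ldots i_M}=a_{i_1\ldots i_Mj_1\ldots j_N}$. The range is $\mathfrak{R}(\mathcal{A})=\{\mathcal{A}*_N\mathcal{X}:\mathcal{X}\text{ a Boolean tensor of size }J_1\times\cdots\times J_N\}$. $\mathcal{A}=\mathcal{F}*_L\mathcal{R}$ is a space decomposition of $\mathcal{A}$ if this equality holds together with $\mathfrak{R}(\mathcal{A})=\mathfrak{R}(\mathcal{F})$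 and $\mathfrak{R}(\mathcal{A}^T)=\mathfrak{R}(\mathcal{R}^T)$. A generalized inverse $\mathcal{A}^{(1)}$ of $\mathcal{A}$ is a Boolean tensor $\mathcal{X}$ of size $J_1\times\cdots\times J_N\times I_1\times\cdots\times I_M$ with $\mathcal{A}*_N\mathcal{X}*_M\mathcal{A}=\mathcal{A}$. *)

theory Defs
  imports Main
begin

text \<open>The binary Boolean algebra \<open>{0,1}\<close> with \<open>1 + 1 = 1\<close>.  It is a separate type rather than
  \<^typ>\<open>bool\<close> so that \<open>+\<close>, \<open>*\<close> and \<open>\<Sum>\<close> are the library's operations.\<close>

datatype bin = Zero | One

instantiation bin :: comm_semiring_1
begin

definition zero_bin :: bin where "0 = Zero"
definition one_bin :: bin where "1 = One"
definition plus_bin :: "bin \<Rightarrow> bin \<Rightarrow> bin" where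
  "a + b = (if a = Zero \<and> b = Zero then Zero else One)"
definition times_bin :: "bin \<Rightarrow> bin \<Rightarrow> bin" where
  "a * b = (if a = One \<and> b = One then One else Zero)"

instance
proof
  fix a b c :: bin
  show "a + b + c = a + (b + c)" "a + b = b + a" "0 + a = a"
    "a * b * c = a * (b * c)" "a * b = b * a" "1 * a = a"
    "0 * a = 0" "a * 0 = 0" "(a + b) * c = a * c + b * c" "(0 :: bin) \<noteq> 1"
    by (cases a; cases b; cases c;
        simp add: zero_bin_def one_bin_def plus_bin_def times_bin_def)+
qed

end

lemma one_plus_one_bin: "(1 :: bin) + 1 = 1"
  by (simp add: one_bin_def plus_bin_def)

text \<open>A size \<open>I\<^sub>1 \<times> \<dots> \<times> I\<^sub>M\<close> is the list \<open>[I\<^sub>1, \<dots>, I\<^sub>M]\<close>.  Indices are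
  counted from 0, so that a multi-index for this size is a list \<open>[i\<^sub>1, \<dots>, i\<^sub>M]\<close> with
  \<open>i\<^sub>k < I\<^sub>k\<close>.\<close>

definition multi_indices :: "nat list \<Rightarrow> nat list set" where
  "multi_indices ds = {ix. list_all2 (<) ix ds}"

lemma length_multi_indices: "ix \<in> multi_indices ds \<Longrightarrow> length ix = length ds"
  by (simp add: multi_indices_def list_all2_lengthD)

lemma finite_multi_indices: "finite (multi_indices ds)"
proof (induction ds)
  case Nil
  then show ?case by (simp add: multi_indices_def)
next
  case (Cons d ds)
  have "multi_indices (d # ds) = (\<lambda>(i, ix). i # ix) ` ({..<d} \<times> multi_indices ds)"
    by (fastforce simp: multi_indices_def list_all2_Cons2)
  with Cons show ?case by simp
qed

lemma append_in_multi_indices: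
  "length ix = length ds \<Longrightarrow>
    ix @ js \<in> multi_indices (ds @ es) \<longleftrightarrow> ix \<in> multi_indices ds \<and> js \<in> multi_indices es"
  by (simp add: multi_indices_def list_all2_append)

text \<open>A Boolean tensor consists of its size and its entries.  Entries outside the size are
  normalized to 0, so that equality of tensors means equal size and equal entries.\<close>

typedef btensor =
  "{p :: nat list \<times> (nat list \<Rightarrow> bin). \<forall>ix. ix \<notin> multi_indices (fst p) \<longrightarrow> snd p ix = 0}"
  by (rule exI[of _ "([], \<lambda>_. 0)"]) simp

setup_lifting type_definition_btensor

lift_definition dims :: "btensor \<Rightarrow> nat list" is fst .

lift_definition entry :: "btensor \<Rightarrow> nat list \<Rightarrow> bin" is snd .

lift_definition tensor_of :: "nat list \<Rightarrow> (nat list \<Rightarrow> bin) \<Rightarrow> btensor"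
  is "\<lambda>ds f. (ds, \<lambda>ix. if ix \<in> multi_indices ds then f ix else 0)"
  by simp

lemma dims_tensor_of [simp]: "dims (tensor_of ds f) = ds"
  by transfer simp

lemma entry_tensor_of:
  "entry (tensor_of ds f) ix = (if ix \<in> multi_indices ds then f ix else 0)"
  by transfer simp

lemma btensor_eq_iff:
  "A = B \<longleftrightarrow> dims A = dims B \<and> (\<forall>ix \<in> multi_indices (dims A). entry A ix = entry B ix)"
  by transfer (metis ext prod_eq_iff)

text \<open>In the following, \<open>N\<close> is the number of trailing modes of \<open>A\<close> that form its column block,
  that is, \<open>A\<close> has size \<open>I\<^sub>1 \<times> \<dots> \<times> I\<^sub>M \<times> J\<^sub>1 \<times> \<dots> \<times> J\<^sub>N\<close>, where
  \<open>M = length (dims A) - N\<close>.  The product \<open>A \<star>\<^bsub>N\<^esub> B\<close> is meant for \<open>B\<close> whose size begins with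
  \<open>J\<^sub>1 \<times> \<dots> \<times> J\<^sub>N\<close>.\<close>

definition einstein_prod :: "btensor \<Rightarrow> nat \<Rightarrow> btensor \<Rightarrow> btensor"
  ("(_ \<star>\<^bsub>_\<^esub> _)" [70, 0, 71] 70) where
  "A \<star>\<^bsub>N\<^esub> B =
    (let M = length (dims A) - N in
      tensor_of (take M (dims A) @ drop N (dims B))
        (\<lambda>ix. \<Sum>js \<in> multi_indices (drop M (dims A)).
            entry A (take M ix @ js) * entry B (js @ drop M ix)))"

definition tensor_transpose :: "nat \<Rightarrow> btensor \<Rightarrow> btensor" where
  "tensor_transpose N A =
    (let M = length (dims A) - N in
      tensor_of (drop M (dims A) @ take M (dims A))
        (\<lambda>ix. entry A (drop N ix @ take N ix)))"

definition tensor_range :: "nat \<Rightarrow> btensor \<Rightarrow> btensor set" where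
  "tensor_range N A = {A \<star>\<^bsub>N\<^esub> X | X. dims X = drop (length (dims A) - N) (dims A)}"

lemma dims_einstein_prod:
  assumes "dims A = Is @ Js" "dims B = Js @ Ks"
  shows "dims (A \<star>\<^bsub>length Js\<^esub> B) = Is @ Ks"
  using assms by (simp add: einstein_prod_def Let_def)

lemma entry_einstein_prod:
  assumes "dims A = Is @ Js" "dims B = Js @ Ks"
    and "ix \<in> multi_indices Is" "ks \<in> multi_indices Ks"
  shows "entry (A \<star>\<^bsub>length Js\<^esub> B) (ix @ ks) =
    (\<Sum>js \<in> multi_indices Js. entry A (ix @ js) * entry B (js @ ks))"
  using assms length_multi_indices[OF assms(3)]
  by (simp add: einstein_prod_def Let_def entry_tensor_of append_in_multi_indices)

lemma dims_tensor_transpose: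
  assumes "dims A = Is @ Js"
  shows "dims (tensor_transpose (length Js) A) = Js @ Is"
  using assms by (simp add: tensor_transpose_def Let_def)

lemma entry_tensor_transpose:
  assumes "dims A = Is @ Js" "ix \<in> multi_indices Is" "js \<in> multi_indices Js"
  shows "entry (tensor_transpose (length Js) A) (js @ ix) = entry A (ix @ js)"
  using assms length_multi_indices[OF assms(3)]
  by (simp add: tensor_transpose_def Let_def entry_tensor_of append_in_multi_indices)

text \<open>\<open>M\<close>, \<open>N\<close>, \<open>L\<close> are the numbers of modes in the \<open>I\<close>-, \<open>J\<close>- and \<open>K\<close>-blocks: \<open>A\<close> has size
  \<open>I \<times> J\<close>, \<open>F\<close> has size \<open>I \<times> K\<close> and \<open>R\<close> has size \<open>K \<times> J\<close>.\<close>

definition space_decomposition ::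
    "nat \<Rightarrow> nat \<Rightarrow> nat \<Rightarrow> btensor \<Rightarrow> btensor \<Rightarrow> btensor \<Rightarrow> bool" where
  "space_decomposition M N L A F R \<longleftrightarrow>
    A = F \<star>\<^bsub>L\<^esub> R \<and>
    tensor_range N A = tensor_range L F \<and>
    tensor_range M (tensor_transpose N A) = tensor_range L (tensor_transpose N R)"

definition generalized_inverse :: "nat \<Rightarrow> nat \<Rightarrow> btensor \<Rightarrow> btensor \<Rightarrow> bool" where
  "generalized_inverse M N A X \<longleftrightarrow>
    dims X = drop M (dims A) @ take M (dims A) \<and>
    A \<star>\<^bsub>N\<^esub> X \<star>\<^bsub>M\<^esub> A = A"

end

theory Submission
  imports Defs
begin

text \<open>Inclusions of ranges are factorizations.  Feeding unit tensors into \<open>F\<close> produces its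
  columns, so \<open>\<R>(F) \<subseteq> \<R>(A)\<close> makes each column of \<open>F\<close> a combination of columns of \<open>A\<close>; collecting
  the coefficients in a tensor \<open>P\<close> gives \<open>F = A P\<close> (lemma \<open>range_subset_imp_factor\<close>).  The same
  fact for transposes turns \<open>\<R>(R\<^sup>T) \<subseteq> \<R>(A\<^sup>T)\<close> into \<open>R = Q A\<close>
  (lemma \<open>transpose_range_subset_imp_factor\<close>).  Then, the Einstein product being associative,
  \<open>A (P Q) A = (A P) (Q A) = F R = A\<close>, so \<open>P Q\<close> is a generalized inverse of \<open>A\<close>.\<close>

lemma multi_indices_Nil [simp]: "multi_indices [] = {[]}"
  by (auto simp: multi_indices_def)

lemma multi_indices_appendE:
  assumes "ms \<in> multi_indices (ds @ es)"
  obtains ix js where "ms = ix @ js" "ix \<in> multi_indices ds" "js \<in> multi_indices es"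
  using assms by (auto simp: multi_indices_def list_all2_append2)

lemma btensor_eqI:
  assumes "dims A = Is @ Js" "dims B = Is @ Js"
    and "\<And>ix js. ix \<in> multi_indices Is \<Longrightarrow> js \<in> multi_indices Js \<Longrightarrow>
      entry A (ix @ js) = entry B (ix @ js)"
  shows "A = B"
  using assms by (auto simp: btensor_eq_iff elim: multi_indices_appendE)

lemma entry_tensor_of_append:
  assumes "ix \<in> multi_indices Is" "js \<in> multi_indices Js"
  shows "entry (tensor_of (Is @ Js) f) (ix @ js) = f (ix @ js)"
  using assms by (simp add: entry_tensor_of append_in_multi_indices length_multi_indices)

lemma entry_einstein_prod_vector:
  assumes "dims A = Is @ Js" "dims x = Js" "ix \<in> multi_indices Is"
  shows "entry (A \<star>\<^bsub>length Js\<^esub> x) ix = (\<Sum>js \<in> multi_indices Js. entry A (ix @ js) * entry x js)"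
  using entry_einstein_prod[of A Is Js x "[]" ix "[]"] assms by simp

lemma einstein_prod_assoc:
  assumes A: "dims A = Is @ Js" and B: "dims B = Js @ Ks" and C: "dims C = Ks @ Ls"
  shows "A \<star>\<^bsub>length Js\<^esub> B \<star>\<^bsub>length Ks\<^esub> C = A \<star>\<^bsub>length Js\<^esub> (B \<star>\<^bsub>length Ks\<^esub> C)"
proof (rule btensor_eqI)
  note AB = dims_einstein_prod[OF A B] and BC = dims_einstein_prod[OF B C]
  show "dims (A \<star>\<^bsub>length Js\<^esub> B \<star>\<^bsub>length Ks\<^esub> C) = Is @ Ls"
    by (rule dims_einstein_prod[OF AB C])
  show "dims (A \<star>\<^bsub>length Js\<^esub> (B \<star>\<^bsub>length Ks\<^esub> C)) = Is @ Ls"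
    by (rule dims_einstein_prod[OF A BC])
  fix ix ls assume i: "ix \<in> multi_indices Is" and l: "ls \<in> multi_indices Ls"
  have "entry (A \<star>\<^bsub>length Js\<^esub> B \<star>\<^bsub>length Ks\<^esub> C) (ix @ ls) =
      (\<Sum>ks \<in> multi_indices Ks. \<Sum>js \<in> multi_indices Js.
        entry A (ix @ js) * entry B (js @ ks) * entry C (ks @ ls))"
    by (simp add: entry_einstein_prod[OF AB C i l] entry_einstein_prod[OF A B i] sum_distrib_right)
  also have "\<dots> = (\<Sum>js \<in> multi_indices Js. \<Sum>ks \<in> multi_indices Ks.
        entry A (ix @ js) * entry B (js @ ks) * entry C (ks @ ls))"
    by (rule sum.swap)
  also have "\<dots> = entry (A \<star>\<^bsub>length Js\<^esub> (B \<star>\<^bsub>length Ks\<^esub> C)) (ix @ ls)"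
    by (simp add: entry_einstein_prod[OF A BC i l] entry_einstein_prod[OF B C _ l]
        sum_distrib_left mult.assoc)
  finally show "entry (A \<star>\<^bsub>length Js\<^esub> B \<star>\<^bsub>length Ks\<^esub> C) (ix @ ls) =
      entry (A \<star>\<^bsub>length Js\<^esub> (B \<star>\<^bsub>length Ks\<^esub> C)) (ix @ ls)" .
qed

lemma tensor_transpose_einstein_prod:
  assumes A: "dims A = Is @ Js" and B: "dims B = Js @ Ks"
  shows "tensor_transpose (length Ks) (A \<star>\<^bsub>length Js\<^esub> B) =
    tensor_transpose (length Ks) B \<star>\<^bsub>length Js\<^esub> tensor_transpose (length Js) A"
proof (rule btensor_eqI)
  note AB = dims_einstein_prod[OF A B]
    and At = dims_tensor_transpose[OF A] and Bt = dims_tensor_transpose[OF B]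
  show "dims (tensor_transpose (length Ks) (A \<star>\<^bsub>length Js\<^esub> B)) = Ks @ Is"
    by (rule dims_tensor_transpose[OF AB])
  show "dims (tensor_transpose (length Ks) B \<star>\<^bsub>length Js\<^esub> tensor_transpose (length Js) A) = Ks @ Is"
    by (rule dims_einstein_prod[OF Bt At])
  fix ks ix assume k: "ks \<in> multi_indices Ks" and i: "ix \<in> multi_indices Is"
  show "entry (tensor_transpose (length Ks) (A \<star>\<^bsub>length Js\<^esub> B)) (ks @ ix) =
    entry (tensor_transpose (length Ks) B \<star>\<^bsub>length Js\<^esub> tensor_transpose (length Js) A) (ks @ ix)"
    by (simp add: entry_tensor_transpose[OF AB i k] entry_einstein_prod[OF A B i k]
        entry_einstein_prod[OF Bt At k i] entry_tensor_transpose[OF A i]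
        entry_tensor_transpose[OF B _ k] mult.commute)
qed

lemma tensor_transpose_transpose:
  assumes A: "dims A = Is @ Js"
  shows "tensor_transpose (length Is) (tensor_transpose (length Js) A) = A"
proof (rule btensor_eqI)
  note At = dims_tensor_transpose[OF A]
  show "dims (tensor_transpose (length Is) (tensor_transpose (length Js) A)) = Is @ Js"
    by (rule dims_tensor_transpose[OF At])
  show "entry (tensor_transpose (length Is) (tensor_transpose (length Js) A)) (ix @ js) =
      entry A (ix @ js)" if "ix \<in> multi_indices Is" "js \<in> multi_indices Js" for ix js
    using that by (simp add: entry_tensor_transpose[OF At] entry_tensor_transpose[OF A])
qed (rule A)

text \<open>The product of \<open>F\<close> with the unit tensor at \<open>ks\<close> is the column of \<open>F\<close> at \<open>ks\<close>.  It lies in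
  the range of \<open>A\<close>, hence equals \<open>A x\<close> for some \<open>x\<close>, and these \<open>x\<close> are the columns of \<open>P\<close>.\<close>

lemma range_subset_imp_factor:
  assumes A: "dims A = Is @ Js" and F: "dims F = Is @ Ks"
    and sub: "tensor_range (length Ks) F \<subseteq> tensor_range (length Js) A"
  obtains P where "dims P = Js @ Ks" "F = A \<star>\<^bsub>length Js\<^esub> P"
proof -
  define unit where "unit ks = tensor_of Ks (\<lambda>ks'. if ks' = ks then 1 else 0)" for ks
  have column: "entry (F \<star>\<^bsub>length Ks\<^esub> unit ks) ix = entry F (ix @ ks)"
    if "ix \<in> multi_indices Is" "ks \<in> multi_indices Ks" for ix ks
  proof -
    have "entry (F \<star>\<^bsub>length Ks\<^esub> unit ks) ix =
        (\<Sum>ks' \<in> multi_indices Ks. entry F (ix @ ks') * entry (unit ks) ks')"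
      using that F by (simp add: entry_einstein_prod_vector unit_def)
    also have "\<dots> = (\<Sum>ks' \<in> multi_indices Ks. if ks' = ks then entry F (ix @ ks') else 0)"
      by (rule sum.cong) (auto simp: unit_def entry_tensor_of)
    also have "\<dots> = entry F (ix @ ks)"
      using that by (simp add: finite_multi_indices)
    finally show ?thesis .
  qed
  have "\<forall>ks. \<exists>x. dims x = Js \<and> F \<star>\<^bsub>length Ks\<^esub> unit ks = A \<star>\<^bsub>length Js\<^esub> x"
  proof
    fix ks
    have "F \<star>\<^bsub>length Ks\<^esub> unit ks \<in> tensor_range (length Ks) F"
      using F by (auto simp: tensor_range_def unit_def)
    then show "\<exists>x. dims x = Js \<and> F \<star>\<^bsub>length Ks\<^esub> unit ks = A \<star>\<^bsub>length Js\<^esub> x"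
      using sub A by (auto simp: tensor_range_def)
  qed
  then obtain x where dims_x: "\<And>ks. dims (x ks) = Js"
    and x: "\<And>ks. F \<star>\<^bsub>length Ks\<^esub> unit ks = A \<star>\<^bsub>length Js\<^esub> x ks"
    by metis
  define P where
    "P = tensor_of (Js @ Ks) (\<lambda>ms. entry (x (drop (length Js) ms)) (take (length Js) ms))"
  have P: "dims P = Js @ Ks"
    by (simp add: P_def)
  have entry_P: "entry P (js @ ks) = entry (x ks) js"
    if "js \<in> multi_indices Js" "ks \<in> multi_indices Ks" for js ks
    using that by (simp add: P_def entry_tensor_of_append length_multi_indices)
  have "F = A \<star>\<^bsub>length Js\<^esub> P"
  proof (rule btensor_eqI[OF F dims_einstein_prod[OF A P]])
    fix ix ks assume i: "ix \<in> multi_indices Is" and k: "ks \<in> multi_indices Ks"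
    have "entry F (ix @ ks) = entry (A \<star>\<^bsub>length Js\<^esub> x ks) ix"
      using column[OF i k] by (simp add: x)
    also have "\<dots> = (\<Sum>js \<in> multi_indices Js. entry A (ix @ js) * entry (x ks) js)"
      by (rule entry_einstein_prod_vector[OF A dims_x i])
    also have "\<dots> = entry (A \<star>\<^bsub>length Js\<^esub> P) (ix @ ks)"
      by (simp add: entry_einstein_prod[OF A P i k] entry_P k)
    finally show "entry F (ix @ ks) = entry (A \<star>\<^bsub>length Js\<^esub> P) (ix @ ks)" .
  qed
  with P show thesis by (rule that)
qed

text \<open>Transposition exchanges the two factors of a product, so a factorization
  \<open>R\<^sup>T = A\<^sup>T Y\<close> gives \<open>R = Y\<^sup>T A\<close>.\<close>

lemma transpose_range_subset_imp_factor:
  assumes A: "dims A = Is @ Js" and R: "dims R = Ks @ Js"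
    and sub: "tensor_range (length Ks) (tensor_transpose (length Js) R)
      \<subseteq> tensor_range (length Is) (tensor_transpose (length Js) A)"
  obtains Q where "dims Q = Ks @ Is" "R = Q \<star>\<^bsub>length Is\<^esub> A"
proof -
  note At = dims_tensor_transpose[OF A] and Rt = dims_tensor_transpose[OF R]
  obtain Y where Y: "dims Y = Is @ Ks"
    and RY: "tensor_transpose (length Js) R = tensor_transpose (length Js) A \<star>\<^bsub>length Is\<^esub> Y"
    using range_subset_imp_factor[OF At Rt sub] .
  have "R = tensor_transpose (length Ks) (tensor_transpose (length Js) R)"
    by (simp add: tensor_transpose_transpose[OF R])
  also have "\<dots> = tensor_transpose (length Ks) Y \<star>\<^bsub>length Is\<^esub> A"
    by (simp add: RY tensor_transpose_einstein_prod[OF At Y] tensor_transpose_transpose[OF A])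
  finally show thesis
    using that dims_tensor_transpose[OF Y] by blast
qed

theorem theorem3p35:
  fixes A F R :: btensor and Is Js Ks :: "nat list"
  assumes "dims A = Is @ Js"
    and "dims F = Is @ Ks"
    and "dims R = Ks @ Js"
    and "space_decomposition (length Is) (length Js) (length Ks) A F R"
  shows "\<exists>X. generalized_inverse (length Is) (length Js) A X"
proof -
  note A = assms(1) and F = assms(2) and R = assms(3)
  have AFR: "A = F \<star>\<^bsub>length Ks\<^esub> R"
    and col: "tensor_range (length Ks) F \<subseteq> tensor_range (length Js) A"
    and row: "tensor_range (length Ks) (tensor_transpose (length Js) R)
      \<subseteq> tensor_range (length Is) (tensor_transpose (length Js) A)"
    using assms(4) unfolding space_decomposition_def by blast+
  obtain P where P: "dims P = Js @ Ks" and FP: "F = A \<star>\<^bsub>length Js\<^esub> P"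
    using range_subset_imp_factor[OF A F col] .
  obtain Q where Q: "dims Q = Ks @ Is" and RQ: "R = Q \<star>\<^bsub>length Is\<^esub> A"
    using transpose_range_subset_imp_factor[OF A R row] .
  have "A \<star>\<^bsub>length Js\<^esub> (P \<star>\<^bsub>length Ks\<^esub> Q) \<star>\<^bsub>length Is\<^esub> A = F \<star>\<^bsub>length Ks\<^esub> Q \<star>\<^bsub>length Is\<^esub> A"
    by (simp add: einstein_prod_assoc[OF A P Q, symmetric] FP[symmetric])
  also have "\<dots> = F \<star>\<^bsub>length Ks\<^esub> R"
    by (simp add: einstein_prod_assoc[OF F Q A] RQ[symmetric])
  also have "\<dots> = A"
    by (rule AFR[symmetric])
  finally have "generalized_inverse (length Is) (length Js) A (P \<star>\<^bsub>length Ks\<^esub> Q)"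
    using A dims_einstein_prod[OF P Q] by (simp add: generalized_inverse_def)
  then show ?thesis ..
qed

end
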